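(* Let $I\subseteq\mathbb{R}$ be an interval, let $g:I\to\mathbb{R}$ be a nonnegative function belonging to the class $Q(I)$, and let $f:I\to\mathbb{R}$ be a real function that is $(g,Q(I))$-convex dominated on $I$. If $a,b\in I$ with $a<b$ and $f,g\in L_1[a,b]$, then $$\left|\frac{4}{b-a}\int_a^b f(x)\,dx-f\left(\frac{a+b}{2}\right)\right|\le \frac{4}{b-a}\int_a^b g(x)\,dx-g\left(\frac{a+b}{2}\right)$$ and $$\left|\frac{f(a)+f(b)}{2}-\frac{1}{b-a}\int_a^b p(x)f(x)\,dx\right|\le \frac{g(a)+g(b)}{2}-\frac{1}{b-a}\int_a^b p(x)g(x)\,dx,$$ where $p(x)=\dfrac{(b-x)(x-a)}{(b-a)^2}$ for $x\in[a,b]$.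
   Context: A function $g:I\to\mathbb{R}$ belongs to the class $Q(I)$ if it is nonnegative and for all $x,y\in I$ and $\lambda\in(0,1)$ it satisfies $g(\lambda x+(1-\lambda)y)\le \frac{g(x)}{\lambda}+\frac{g(y)}{1-\lambda}$. Given a nonnegative $g\in Q(I)$, a function $f:I\to\mathbb{R}$ is called $(g,Q(I))$-convex dominated on $I$ if for all $x,y\in I$ and $\lambda\in(0,1)$, $$\left|\frac{f(x)}{\lambda}+\frac{f(y)}{1-\lambda}-f(\lambda x+(1-\lambda)y)\right|\le \frac{g(x)}{\lambda}+\frac{g(y)}{1-\lambda}-g(\lambda x+(1-\lambda)y).$$ $L_1[a,b]$ denotes the Lebesgue integrable functions on $[a,b]$. *)

theory Defs
  imports "HOL-Analysis.Analysis"
begin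

(* Functions I -> R are total functions of which only the values on I are constrained. *)

definition class_Q :: "real set \<Rightarrow> (real \<Rightarrow> real) set" where
  "class_Q I = {g. (\<forall>x\<in>I. 0 \<le> g x) \<and>
     (\<forall>x\<in>I. \<forall>y\<in>I. \<forall>t\<in>{0<..<1}.
        g (t * x + (1 - t) * y) \<le> g x / t + g y / (1 - t))}"

(* As in the usual convention, g is meant to lie in class_Q I; users assume this separately. *)
definition Q_convex_dominated ::
    "(real \<Rightarrow> real) \<Rightarrow> real set \<Rightarrow> (real \<Rightarrow> real) \<Rightarrow> bool" where
  "Q_convex_dominated g I f \<longleftrightarrow>
     (\<forall>x\<in>I. \<forall>y\<in>I. \<forall>t\<in>{0<..<1}.
        \<bar>f x / t + f y / (1 - t) - f (t * x + (1 - t) * y)\<bar>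
          \<le> g x / t + g y / (1 - t) - g (t * x + (1 - t) * y))"

end

theory Submission
  imports Defs
begin

text \<open>
  The domination inequality \<open>\<bar>F\<bar> \<le> G\<close> says that \<open>G + F\<close> and \<open>G - F\<close> are nonnegative, and the
  expressions \<open>F\<close>, \<open>G\<close> are the same linear functional of \<open>f\<close> and of \<open>g\<close>.  So if
  \<open>f\<close> is dominated by \<open>g\<close>, then \<open>g + f\<close> and \<open>g - f\<close> both lie in \<open>class_Q I\<close>
  (\<open>class_Q_if_dominated\<close>).  The two conclusions have the same shape, so each of them amounts to
  a one-sided Hermite--Hadamard inequality for a single function \<open>h\<close> in \<open>class_Q I\<close>, to be applied
  to \<open>g + f\<close> and to \<open>g - f\<close>.

  For the midpoint (\<open>class_Q_midpoint_le_integral\<close>), the defining inequality at \<open>t = 1/2\<close> gives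
  \<open>h ((a + b) / 2) \<le> 2 * h x + 2 * h (a + b - x)\<close>, and both terms on the right have the same
  integral over \<open>[a, b]\<close>.

  For the endpoints (\<open>class_Q_weighted_integral_le\<close>), write \<open>x = t * a + (1 - t) * b\<close>.
  The weight of the theorem is exactly \<open>t * (1 - t)\<close>, and multiplying the defining inequality by it
  clears the denominators: \<open>t * (1 - t) * h x \<le> (1 - t) * h a + t * h b\<close>.  The right-hand side is
  affine in \<open>x\<close> and has mean \<open>(h a + h b) / 2\<close>.
\<close>

section \<open>Dominated functions and the class Q\<close>

lemma class_QD:
  assumes "h \<in> class_Q I" "x \<in> I" "y \<in> I" "0 < t" "t < 1"
  shows "h (t * x + (1 - t) * y) \<le> h x / t + h y / (1 - t)"
  using assms by (auto simp: class_Q_def)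

text \<open>
  The inequality forces nonnegativity: with \<open>x = y\<close> and \<open>t = 1/2\<close> it reads \<open>h x \<le> 4 * h x\<close>.
\<close>
lemma class_QI:
  assumes Q: "\<And>x y t. \<lbrakk>x \<in> I; y \<in> I; 0 < t; t < 1\<rbrakk> \<Longrightarrow>
      h (t * x + (1 - t) * y) \<le> h x / t + h y / (1 - t)"
  shows "h \<in> class_Q I"
proof -
  have "0 \<le> h x" if "x \<in> I" for x
    using Q[OF that that, of "1/2"] by simp
  with Q show ?thesis by (auto simp: class_Q_def)
qed

lemma class_Q_if_dominated:
  assumes "Q_convex_dominated g I f"
  shows "(\<lambda>x. g x + f x) \<in> class_Q I" and "(\<lambda>x. g x - f x) \<in> class_Q I"
proof -
  have dom: "\<bar>f x / t + f y / (1 - t) - f (t * x + (1 - t) * y)\<bar>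
      \<le> g x / t + g y / (1 - t) - g (t * x + (1 - t) * y)"
    if "x \<in> I" "y \<in> I" "0 < t" "t < 1" for x y t
    using assms that by (auto simp: Q_convex_dominated_def)
  show "(\<lambda>x. g x + f x) \<in> class_Q I"
  proof (rule class_QI)
    fix x y t :: real
    assume "x \<in> I" "y \<in> I" "0 < t" "t < 1"
    from dom[OF this] show "g (t * x + (1 - t) * y) + f (t * x + (1 - t) * y)
        \<le> (g x + f x) / t + (g y + f y) / (1 - t)"
      unfolding add_divide_distrib by linarith
  qed
  show "(\<lambda>x. g x - f x) \<in> class_Q I"
  proof (rule class_QI)
    fix x y t :: real
    assume "x \<in> I" "y \<in> I" "0 < t" "t < 1"
    from dom[OF this] show "g (t * x + (1 - t) * y) - f (t * x + (1 - t) * y)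
        \<le> (g x - f x) / t + (g y - f y) / (1 - t)"
      unfolding diff_divide_distrib by linarith
  qed
qed

section \<open>Hermite--Hadamard inequalities for the class Q\<close>

lemma has_integral_reflect_about_midpoint:
  fixes h :: "real \<Rightarrow> real"
  assumes "(h has_integral J) {a..b}"
  shows "((\<lambda>x. h (a + b - x)) has_integral J) {a..b}"
proof -
  have "(\<lambda>x. a + b - x) ` {a..b} = {a..b}"
    by (simp add: image_diff_atLeastAtMost)
  with has_integral_affinity[of h J a b "-1" "a + b"] assms show ?thesis
    by (simp add: add.commute)
qed

lemma class_Q_midpoint_le_integral:
  assumes h: "h \<in> class_Q I" and sub: "{a..b} \<subseteq> I" and "a < b"
    and J: "(h has_integral J) {a..b}"
  shows "h ((a + b) / 2) \<le> 4 / (b - a) * J"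
proof -
  have le: "h ((a + b) / 2) \<le> 2 * h x + 2 * h (a + b - x)" if "x \<in> {a..b}" for x
  proof -
    have mid: "1 / 2 * x + (1 - 1 / 2) * (a + b - x) = (a + b) / 2"
      by (simp add: field_simps)
    have "x \<in> I" "a + b - x \<in> I" using that sub by auto
    from class_QD[OF h this, of "1 / 2"] show ?thesis unfolding mid by simp
  qed
  have "((\<lambda>x. h ((a + b) / 2)) has_integral (b - a) * h ((a + b) / 2)) {a..b}"
    using has_integral_const_real[of "h ((a + b) / 2)" a b] \<open>a < b\<close> by simp
  moreover have "((\<lambda>x. 2 * h x + 2 * h (a + b - x)) has_integral 2 * J + 2 * J) {a..b}"
    by (intro has_integral_add has_integral_mult_right J has_integral_reflect_about_midpoint)
  ultimately have "(b - a) * h ((a + b) / 2) \<le> 2 * J + 2 * J"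
    using le by (rule has_integral_le)
  with \<open>a < b\<close> show ?thesis by (simp add: field_simps)
qed

lemma class_Q_weighted_le_affine:
  assumes h: "h \<in> class_Q I" and "a \<in> I" "b \<in> I" and "a < b" and x: "x \<in> {a..b}"
  shows "(b - x) * (x - a) / (b - a)\<^sup>2 * h x \<le> ((x - a) * h a + (b - x) * h b) / (b - a)"
proof (cases "x = a \<or> x = b")
  \<comment> \<open>At the endpoints the parameter \<open>t\<close> leaves the open interval, but there the weight vanishes
    and nonnegativity of \<open>h\<close> suffices.\<close>
  case True
  moreover have "0 \<le> h a" "0 \<le> h b" using assms by (auto simp: class_Q_def)
  ultimately show ?thesis using \<open>a < b\<close> by auto
next
  case False
  define t where "t = (b - x) / (b - a)"
  have t: "0 < t" "t < 1" using False x \<open>a < b\<close> by (auto simp: t_def)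
  have t': "1 - t = (x - a) / (b - a)" using \<open>a < b\<close> by (simp add: t_def field_simps)
  have "t * a + (1 - t) * b = b - t * (b - a)" by (simp add: algebra_simps)
  also have "\<dots> = x" using \<open>a < b\<close> by (simp add: t_def)
  finally have "h x \<le> h a / t + h b / (1 - t)"
    using class_QD[OF h \<open>a \<in> I\<close> \<open>b \<in> I\<close> t] by simp
  then have "(t * (1 - t)) * h x \<le> (t * (1 - t)) * (h a / t + h b / (1 - t))"
    using t by (intro mult_left_mono) auto
  also have "\<dots> = (1 - t) * h a + t * h b" using t by (simp add: field_simps)
  finally have "t * (1 - t) * h x \<le> (1 - t) * h a + t * h b" .
  then show ?thesis
    unfolding t' by (simp add: t_def power2_eq_square add_divide_distrib)
qed

lemma class_Q_weighted_integral_le: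
  assumes h: "h \<in> class_Q I" and "a \<in> I" "b \<in> I" and "a < b"
    and J: "((\<lambda>x. (b - x) * (x - a) / (b - a)\<^sup>2 * h x) has_integral J) {a..b}"
  shows "1 / (b - a) * J \<le> (h a + h b) / 2"
proof -
  define F where "F x = ((x - a)\<^sup>2 * h a - (b - x)\<^sup>2 * h b) / (2 * (b - a))" for x
  have "((\<lambda>x. ((x - a) * h a + (b - x) * h b) / (b - a)) has_integral F b - F a) {a..b}"
  proof (rule fundamental_theorem_of_calculus)
    fix x
    have "((\<lambda>x. (x - a)\<^sup>2 * h a - (b - x)\<^sup>2 * h b) has_real_derivative
        2 * ((x - a) * h a + (b - x) * h b)) (at x within {a..b})"
      by (auto intro!: derivative_eq_intros simp: algebra_simps)
    from DERIV_cdivide[OF this, of "2 * (b - a)"]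
    have "(F has_real_derivative ((x - a) * h a + (b - x) * h b) / (b - a)) (at x within {a..b})"
      unfolding F_def mult_divide_mult_cancel_left[OF zero_neq_numeral[symmetric]] .
    then show "(F has_vector_derivative ((x - a) * h a + (b - x) * h b) / (b - a))
        (at x within {a..b})"
      by (simp add: has_real_derivative_iff_has_vector_derivative)
  qed (use \<open>a < b\<close> in simp)
  from has_integral_le[OF J this class_Q_weighted_le_affine[OF assms(1-4)]]
  have "J \<le> F b - F a" .
  also have "F b - F a = (b - a) * ((h a + h b) / 2)"
    using \<open>a < b\<close>
    by (simp add: F_def power2_eq_square add_divide_distrib distrib_left
        del: right_diff_distrib_numeral)
  finally show ?thesis using \<open>a < b\<close> by (simp add: field_simps)
qed

section \<open>Hermite--Hadamard inequalities for dominated functions\<close>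

lemma set_integrable_weighted:
  fixes f w :: "real \<Rightarrow> real"
  assumes "continuous_on {a..b} w" and "set_integrable lebesgue {a..b} f"
  shows "set_integrable lebesgue {a..b} (\<lambda>x. w x * f x)"
proof (rule absolutely_integrable_bounded_measurable_product_real)
  show "w \<in> borel_measurable (lebesgue_on {a..b})"
    using assms(1) by (rule continuous_imp_measurable_on_sets_lebesgue) simp
  show "bounded (w ` {a..b})"
    using assms(1) by (intro compact_imp_bounded compact_continuous_image) auto
qed (use assms in auto)

theorem theorem3:
  fixes I :: "real set" and f g p :: "real \<Rightarrow> real" and a b :: real
  assumes "is_interval I"
    and "g \<in> class_Q I"
    and "Q_convex_dominated g I f"
    and "a \<in> I" and "b \<in> I" and "a < b"
    and "set_integrable lebesgue {a..b} f"
    and "set_integrable lebesgue {a..b} g"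
    and "\<And>x. x \<in> {a..b} \<Longrightarrow> p x = (b - x) * (x - a) / (b - a)\<^sup>2"
  shows "\<bar>4 / (b - a) * (LINT x:{a..b}|lebesgue. f x) - f ((a + b) / 2)\<bar>
           \<le> 4 / (b - a) * (LINT x:{a..b}|lebesgue. g x) - g ((a + b) / 2)
       \<and> \<bar>(f a + f b) / 2 - 1 / (b - a) * (LINT x:{a..b}|lebesgue. p x * f x)\<bar>
           \<le> (g a + g b) / 2 - 1 / (b - a) * (LINT x:{a..b}|lebesgue. p x * g x)"
proof -
  let ?w = "\<lambda>x. (b - x) * (x - a) / (b - a)\<^sup>2"
  have sub: "{a..b} \<subseteq> I"
    using assms(1,4,5) by (meson atLeastAtMost_iff is_interval_1 subsetI)
  note Q = class_Q_if_dominated[OF assms(3)]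
  define F G Fw Gw where ints:
    "F = (LINT x:{a..b}|lebesgue. f x)" "G = (LINT x:{a..b}|lebesgue. g x)"
    "Fw = (LINT x:{a..b}|lebesgue. p x * f x)" "Gw = (LINT x:{a..b}|lebesgue. p x * g x)"
  have F: "(f has_integral F) {a..b}" and G: "(g has_integral G) {a..b}"
    unfolding ints by (rule has_integral_set_lebesgue, fact)+
  have weighted: "((\<lambda>x. ?w x * u x) has_integral (LINT x:{a..b}|lebesgue. p x * u x)) {a..b}"
    if "set_integrable lebesgue {a..b} u" for u
  proof -
    have "continuous_on {a..b} ?w"
      using \<open>a < b\<close> by (intro continuous_intros) auto
    from has_integral_set_lebesgue[OF set_integrable_weighted[OF this that]]
    have "((\<lambda>x. ?w x * u x) has_integral (LINT x:{a..b}|lebesgue. ?w x * u x)) {a..b}" .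
    also have "(LINT x:{a..b}|lebesgue. ?w x * u x) = (LINT x:{a..b}|lebesgue. p x * u x)"
      using assms(9) by (intro set_lebesgue_integral_cong) auto
    finally show ?thesis .
  qed
  have Fw: "((\<lambda>x. ?w x * f x) has_integral Fw) {a..b}"
    and Gw: "((\<lambda>x. ?w x * g x) has_integral Gw) {a..b}"
    unfolding ints by (rule weighted, fact)+

  have "g ((a + b) / 2) + f ((a + b) / 2) \<le> 4 / (b - a) * (G + F)"
    using class_Q_midpoint_le_integral[OF Q(1) sub \<open>a < b\<close> has_integral_add[OF G F]] .
  moreover have "g ((a + b) / 2) - f ((a + b) / 2) \<le> 4 / (b - a) * (G - F)"
    using class_Q_midpoint_le_integral[OF Q(2) sub \<open>a < b\<close> has_integral_diff[OF G F]] .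
  ultimately have midpoint:
    "\<bar>4 / (b - a) * F - f ((a + b) / 2)\<bar> \<le> 4 / (b - a) * G - g ((a + b) / 2)"
    unfolding distrib_left right_diff_distrib by linarith

  have "1 / (b - a) * (Gw + Fw) \<le> ((g a + f a) + (g b + f b)) / 2"
    using has_integral_add[OF Gw Fw]
    by (intro class_Q_weighted_integral_le[OF Q(1) assms(4-6)]) (simp only: distrib_left)
  moreover have "1 / (b - a) * (Gw - Fw) \<le> ((g a - f a) + (g b - f b)) / 2"
    using has_integral_diff[OF Gw Fw]
    by (intro class_Q_weighted_integral_le[OF Q(2) assms(4-6)]) (simp only: right_diff_distrib)
  ultimately have endpoints:
    "\<bar>(f a + f b) / 2 - 1 / (b - a) * Fw\<bar> \<le> (g a + g b) / 2 - 1 / (b - a) * Gw"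
    unfolding distrib_left right_diff_distrib add_divide_distrib diff_divide_distrib abs_le_iff
    by auto
  from midpoint endpoints show ?thesis
    unfolding ints ..
qed

end
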